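(* Let $n>2$ and let $S$ be $\mathbb{T}$ or $R$. Let $\pi$ and $\sigma$ be two different permutations in $S_n$ for which there exists $t\in\mathbb{Z}_n$, with $t\ne \frac n2$ if $n$ is even, such that $\pi(i)=\sigma(i)+t\pmod n$ for all $i$. Let $D_{\pi},D_{\sigma}\in M_n(S)$ be invertible matrices such that the $(i,j)$ entry of $D_\pi$ is an element of $\mathcal{G}$ if $j=\pi(i)$ and is $-\infty$ otherwise, and the $(i,j)$ entry of $D_\sigma$ is an element of $\mathcal{G}$ if $j=\sigma(i)$ and is $-\infty$ otherwise. Then the matrix $A=D_{\pi}+D_{\sigma}$ is not factorizable over $S$.
   Context: Let $\mathcal{G}$ be a totally ordered abelian group, e.g. $(\mathbb{R},+)$ or $(\mathbb{Q},+)$. The tropical semifield is $\mathbb{T}=\mathcal{G}\cup\{-\infty\}$ with addition $\max$ and multiplication the group operation; its zero is $-\infty$ and its one is the identity of $\mathcal{G}$. The supertropical semiring is $R=\mathcal{G}\cup\mathcal{G}^{\nu}\cup\{-\infty\}$, where $\mathcal{G}$ is the set of tangible elements and $\mathcal{G}^{\nu}=\{a^{\nu}:a\in\mathcal{G}\}$ is a disjoint ordered copy of $\mathcal{G}$ (the ghost elements). Put $(a^{\nu})^{\nu}=a^{\nu}$ and $(-\infty)^\nu=-\infty$; elements are compared through their $\nu$-values $a^\nu$. Addition: $a+b$ is the one of larger $\nu$-value if $a^{\nu}\ne b^{\nu}$, and $a+b=a^{\nu}$ if $a^{\nu}=b^{\nu}$. Multiplication is the group operation on the underlying elements of $\mathcal{G}$,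 the product being ghost if at least one factor is ghost; $-\infty$ is additively neutral and multiplicatively absorbing. $0_R=-\infty$, and $1_R$ is the (tangible) identity of $\mathcal{G}$. Permutations in $S_n$ act on $\{1,\dots,n\}$, identified with $\mathbb{Z}_n$. Elementary matrices over $S$: type 1, the identity matrix with two rows switched; type 2, the identity matrix with one diagonal entry replaced by some $k\in\mathcal{G}$; type 3, the identity matrix with one off-diagonal entry replaced by some $k\in\mathcal{G}$. A matrix is factorizable over $S$ if it is equal to a finite product of elementary matrices over $S$. *)

theory Defs
  imports
    "HOL-Combinatorics.Permutations"
    "HOL-Number_Theory.Cong"
    "Jordan_Normal_Form.Gauss_Jordan_Elimination"
begin

datatype 'g tropical = MinusInf | Trop 'g

instantiation tropical :: (linorder) linorder
begin

fun less_eq_tropical :: "'a tropical \<Rightarrow> 'a tropical \<Rightarrow> bool" where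
  "MinusInf \<le> y \<longleftrightarrow> True"
| "Trop a \<le> MinusInf \<longleftrightarrow> False"
| "Trop a \<le> Trop b \<longleftrightarrow> a \<le> b"

definition less_tropical :: "'a tropical \<Rightarrow> 'a tropical \<Rightarrow> bool" where
  "x < y \<longleftrightarrow> x \<le> y \<and> \<not> y \<le> x" for x y :: "'a tropical"

instance
proof
  fix x y z :: "'a tropical"
  show "x < y \<longleftrightarrow> x \<le> y \<and> \<not> y \<le> x" by (rule less_tropical_def)
  show "x \<le> x" by (cases x) auto
  show "x \<le> y \<Longrightarrow> y \<le> z \<Longrightarrow> x \<le> z" by (cases x; cases y; cases z) auto
  show "x \<le> y \<Longrightarrow> y \<le> x \<Longrightarrow> x = y" by (cases x; cases y) auto
  show "x \<le> y \<or> y \<le> x" by (cases x; cases y) auto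
qed

end

instantiation tropical :: (linordered_ab_group_add) comm_semiring_1
begin

definition zero_tropical :: "'a tropical" where "0 = MinusInf"

definition one_tropical :: "'a tropical" where "1 = Trop 0"

definition plus_tropical :: "'a tropical \<Rightarrow> 'a tropical \<Rightarrow> 'a tropical" where
  "x + y = max x y" for x y :: "'a tropical"

fun times_tropical :: "'a tropical \<Rightarrow> 'a tropical \<Rightarrow> 'a tropical" where
  "MinusInf * y = MinusInf"
| "Trop a * MinusInf = MinusInf"
| "Trop a * Trop b = Trop (a + b)"

instance
proof
  fix x y z :: "'a tropical"
  show "x + y + z = x + (y + z)" by (simp add: plus_tropical_def max.assoc)
  show "x + y = y + x" by (simp add: plus_tropical_def max.commute)
  show "0 + x = x" by (cases x) (auto simp: plus_tropical_def zero_tropical_def max_def)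
  show "x * y * z = x * (y * z)" by (cases x; cases y; cases z) (auto simp: add.assoc)
  show "x * y = y * x" by (cases x; cases y) (auto simp: add.commute)
  show "1 * x = x" by (cases x) (auto simp: one_tropical_def)
  show "(x + y) * z = x * z + y * z"
    by (cases x; cases y; cases z) (auto simp: plus_tropical_def max_def)
  show "0 * x = 0" "x * 0 = 0" by (cases x; simp add: zero_tropical_def)+
  show "(0 :: 'a tropical) \<noteq> 1" by (simp add: zero_tropical_def one_tropical_def)
qed

end

datatype 'g supertropical = SMinusInf | Tangible 'g | Ghost 'g

fun ghost_map :: "'g supertropical \<Rightarrow> 'g supertropical" where
  "ghost_map SMinusInf = SMinusInf"
| "ghost_map (Tangible a) = Ghost a"
| "ghost_map (Ghost a) = Ghost a"

text \<open>
  The ghosts together with \<open>SMinusInf\<close> form an ordered copy of \<open>'g tropical\<close>;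
  \<open>nu_value x\<close> is the element of that copy corresponding to \<open>ghost_map x\<close>, so that
  elements are compared through their \<open>\<nu>\<close>-values by comparing their \<open>nu_value\<close>.
\<close>

fun nu_value :: "'g supertropical \<Rightarrow> 'g tropical" where
  "nu_value SMinusInf = MinusInf"
| "nu_value (Tangible a) = Trop a"
| "nu_value (Ghost a) = Trop a"

lemma nu_value_eq_iff: "nu_value x = nu_value y \<longleftrightarrow> ghost_map x = ghost_map y"
  by (cases x; cases y) auto

instantiation supertropical :: (linordered_ab_group_add) comm_semiring_1
begin

definition zero_supertropical :: "'a supertropical" where "0 = SMinusInf"

definition one_supertropical :: "'a supertropical" where "1 = Tangible 0"

definition plus_supertropical ::
    "'a supertropical \<Rightarrow> 'a supertropical \<Rightarrow> 'a supertropical" where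
  "x + y = (if nu_value x < nu_value y then y
            else if nu_value y < nu_value x then x
            else ghost_map x)"

fun times_supertropical ::
    "'a supertropical \<Rightarrow> 'a supertropical \<Rightarrow> 'a supertropical" where
  "SMinusInf * y = SMinusInf"
| "Tangible a * SMinusInf = SMinusInf"
| "Ghost a * SMinusInf = SMinusInf"
| "Tangible a * Tangible b = Tangible (a + b)"
| "Tangible a * Ghost b = Ghost (a + b)"
| "Ghost a * Tangible b = Ghost (a + b)"
| "Ghost a * Ghost b = Ghost (a + b)"

instance
proof
  fix x y z :: "'a supertropical"
  show "x + y + z = x + (y + z)"
    by (cases x; cases y; cases z) (auto simp: plus_supertropical_def less_tropical_def)
  show "x + y = y + x"
    by (cases x; cases y) (auto simp: plus_supertropical_def less_tropical_def)
  show "0 + x = x"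
    by (cases x) (auto simp: plus_supertropical_def zero_supertropical_def less_tropical_def)
  show "x * y * z = x * (y * z)" by (cases x; cases y; cases z) (auto simp: add.assoc)
  show "x * y = y * x" by (cases x; cases y) (auto simp: add.commute)
  show "1 * x = x" by (cases x) (auto simp: one_supertropical_def)
  show "(x + y) * z = x * z + y * z"
    by (cases x; cases y; cases z) (auto simp: plus_supertropical_def less_tropical_def)
  show "0 * x = 0" "x * 0 = 0" by (cases x; simp add: zero_supertropical_def)+
  show "(0 :: 'a supertropical) \<noteq> 1"
    by (simp add: zero_supertropical_def one_supertropical_def)
qed

end

text \<open>
  Below, \<open>G\<close> is the set of elements of the semiring that come from the group: \<open>range Trop\<close> for
  the tropical semifield and \<open>range Tangible\<close> for the supertropical semiring.  Note that
  \<open>addrow_mat n k i j\<close> has the entry \<open>k + 0 = k\<close> at position \<open>(i, j)\<close> when \<open>i \<noteq> j\<close>, as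
  required for type 3.
\<close>

inductive elementary_mat :: "'s :: comm_semiring_1 set \<Rightarrow> nat \<Rightarrow> 's mat \<Rightarrow> bool"
  for G :: "'s set" and n :: nat where
  type1: "i < n \<Longrightarrow> j < n \<Longrightarrow> i \<noteq> j \<Longrightarrow> elementary_mat G n (swaprows_mat n i j)"
| type2: "i < n \<Longrightarrow> k \<in> G \<Longrightarrow> elementary_mat G n (multrow_mat n i k)"
| type3: "i < n \<Longrightarrow> j < n \<Longrightarrow> i \<noteq> j \<Longrightarrow> k \<in> G \<Longrightarrow> elementary_mat G n (addrow_mat n k i j)"

definition factorizable :: "'s :: comm_semiring_1 set \<Rightarrow> nat \<Rightarrow> 's mat \<Rightarrow> bool" where
  "factorizable G n A \<longleftrightarrow>
     (\<exists>Es. (\<forall>E \<in> set Es. elementary_mat G n E) \<and> A = foldr (*) Es (1\<^sub>m n))"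

text \<open>
  The index set is \<open>{..<n}\<close>, the least nonnegative representatives of the integers modulo \<open>n\<close>.
\<close>

definition perm_supported ::
    "'s :: comm_semiring_1 set \<Rightarrow> nat \<Rightarrow> (nat \<Rightarrow> nat) \<Rightarrow> 's mat \<Rightarrow> bool" where
  "perm_supported G n \<pi> D \<longleftrightarrow> D \<in> carrier_mat n n \<and>
     (\<forall>i<n. \<forall>j<n. if j = \<pi> i then D $$ (i, j) \<in> G else D $$ (i, j) = 0)"

end

(*
  A supported by two disjoint permutations with shift t, 2t \<noteq> 0 (mod n), has pairwise incomparable
  row supports: two distinct rows share both columns only if 2t = 0.  Over a semiring without zero
  divisors and zero sums, a leftmost type 3 factor forces one row support of the product to contain
  another, whereas factors of types 1 and 2 only permute the row supports.  Hence a factorization of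
  A would only use types 1 and 2, and every row of A would have a single nonzero entry.
*)
theory Submission
  imports Defs
begin

definition row_support :: "'s :: zero mat \<Rightarrow> nat \<Rightarrow> nat set" where
  "row_support A i = {j. j < dim_col A \<and> A $$ (i, j) \<noteq> 0}"

lemma row_support_swaprows:
  assumes "A \<in> carrier_mat n nc" and "i < n" and "k < n" "l < n"
  shows "row_support (swaprows k l A) i = row_support A (transpose k l i)"
  using assms unfolding row_support_def by (auto simp: transpose_def)

lemma row_support_multrow:
  fixes A :: "'s :: {semiring_1, semiring_no_zero_divisors} mat"
  assumes "A \<in> carrier_mat n nc" and "i < n" and "k \<noteq> 0"
  shows "row_support (multrow l k A) i = row_support A i"
  using assms unfolding row_support_def by (auto split: if_splits)

lemma row_support_addrow_other:
  assumes "A \<in> carrier_mat n nc" and "i < n" and "i \<noteq> k"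
  shows "row_support (addrow a k l A) i = row_support A i"
  using assms unfolding row_support_def by auto

text \<open>Row \<open>k\<close> gains \<open>a\<close> times row \<open>l\<close>. Without zero
  divisors this multiple keeps every nonzero entry of row \<open>l\<close>, and without zero sums
  the old entries of row \<open>k\<close> cannot cancel any of them.\<close>

lemma row_support_addrow_superset:
  fixes A :: "'s :: {semiring_1, semiring_no_zero_divisors} mat"
  assumes zero_sum_free: "\<forall>x y :: 's. x + y = 0 \<longrightarrow> x = 0"
    and "A \<in> carrier_mat n nc" and "k < n" and "a \<noteq> 0"
  shows "row_support A l \<subseteq> row_support (addrow a k l A) k"
proof
  fix j assume "j \<in> row_support A l"
  then have j: "j < dim_col A" and "a * A $$ (l, j) \<noteq> 0"
    using \<open>a \<noteq> 0\<close> by (auto simp: row_support_def)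
  then have "a * A $$ (l, j) + A $$ (k, j) \<noteq> 0"
    using zero_sum_free by blast
  then show "j \<in> row_support (addrow a k l A) k"
    using assms(2,3) j by (auto simp: row_support_def)
qed

lemma elementary_mat_carrier: "elementary_mat G n E \<Longrightarrow> E \<in> carrier_mat n n"
  by (induction rule: elementary_mat.induct) auto

lemma elementary_product_carrier:
  assumes "\<forall>E \<in> set Es. elementary_mat G n E"
  shows "foldr (*) Es (1\<^sub>m n) \<in> carrier_mat n n"
  using assms by (induction Es) (auto intro!: mult_carrier_mat dest: elementary_mat_carrier)

text \<open>Incomparability is phrased through indices, so it also excludes two distinct rows with
  equal support. In the induction it has to be handed from a product to the tail behind its leftmost
  factor; the bound 1 comes from the empty product, the identity.\<close>

lemma elementary_product_antichain_rows:
  fixes G :: "'s :: {comm_semiring_1, semiring_no_zero_divisors} set"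
  assumes zero_sum_free: "\<forall>x y :: 's. x + y = 0 \<longrightarrow> x = 0" and G: "0 \<notin> G"
    and "\<forall>E \<in> set Es. elementary_mat G n E"
    and "\<And>i j. i < n \<Longrightarrow> j < n \<Longrightarrow>
      row_support (foldr (*) Es (1\<^sub>m n)) i \<subseteq> row_support (foldr (*) Es (1\<^sub>m n)) j \<Longrightarrow> i = j"
    and "i < n"
  shows "card (row_support (foldr (*) Es (1\<^sub>m n)) i) \<le> 1"
  using assms(3-)
proof (induction Es arbitrary: i)
  case Nil
  have "row_support (1\<^sub>m n :: 's mat) i = {i}"
    using Nil.prems(3) by (auto simp: row_support_def split: if_splits)
  then show ?case by simp
next
  case (Cons E Es)
  define B where "B = foldr (*) Es (1\<^sub>m n)"
  have Es: "\<forall>E \<in> set Es. elementary_mat G n E" and E: "elementary_mat G n E"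
    using Cons.prems(1) by auto
  have B: "B \<in> carrier_mat n n"
    unfolding B_def by (rule elementary_product_carrier[OF Es])
  have antichain: "i = j"
    if "i < n" "j < n" "row_support (E * B) i \<subseteq> row_support (E * B) j" for i j
    using Cons.prems(2) that by (simp add: B_def)
  have IH: "card (row_support B i) \<le> 1"
    if "\<And>i j. i < n \<Longrightarrow> j < n \<Longrightarrow> row_support B i \<subseteq> row_support B j \<Longrightarrow> i = j"
      and "i < n" for i
    using Cons.IH[OF Es] that unfolding B_def by blast
  from E have "card (row_support (E * B) i) \<le> 1"
  proof cases
    case (type1 k l)
    have supp: "row_support (E * B) i = row_support B (transpose k l i)" if "i < n" for i
      using row_support_swaprows[OF B that type1(2,3)] swaprows_mat[OF B type1(2,3)] type1(1)
      by simp
    have bound: "transpose k l i < n" if "i < n" for i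
      using that type1 by (simp add: transpose_def)
    \<comment> \<open>A transposition is its own inverse, so row \<open>i\<close> of
      \<open>B\<close> is row \<open>transpose k l i\<close> of \<open>E * B\<close>, and an
      inclusion between rows of \<open>B\<close> is one between rows of
      \<open>E * B\<close>.\<close>
    have "i = j" if "i < n" "j < n" "row_support B i \<subseteq> row_support B j" for i j
    proof -
      have "transpose k l i = transpose k l j"
        using antichain[OF bound[OF that(1)] bound[OF that(2)]] that
        by (simp add: supp bound)
      then show ?thesis by (metis transpose_involutory)
    qed
    then show ?thesis
      using IH supp bound Cons.prems(3) by simp
  next
    case (type2 l k)
    have "k \<noteq> 0" using type2 G by auto
    then have supp: "row_support (E * B) i = row_support B i" if "i < n" for i
      using row_support_multrow[OF B that] multrow_mat[OF B] type2(1) by metis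
    then show ?thesis
      using IH antichain Cons.prems(3) by simp
  next
    case (type3 k l a)
    have EB: "E * B = addrow a k l B"
      using addrow_mat[OF B type3(3)] type3(1) by simp
    have "a \<noteq> 0" using type3 G by auto
    \<comment> \<open>Row \<open>l\<close> is untouched because \<open>l\<close> differs from
      \<open>k\<close>, so its support lies within that of the enlarged row \<open>k\<close>. This
      contradicts incomparability, and the case closes without the induction hypothesis.\<close>
    then have "row_support (E * B) l \<subseteq> row_support (E * B) k"
      using row_support_addrow_other[OF B type3(3), of k a l]
        row_support_addrow_superset[OF zero_sum_free B type3(2), of a l] type3 EB
      by simp
    then show ?thesis
      using antichain[OF type3(3,2)] type3(4) by simp
  qed
  then show ?case by (simp add: B_def)
qed

text \<open>The pairs are the row supports of the sum. By injectivity an inclusion between different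
  rows can match the values only crosswise, and then two shifts by \<open>t\<close> lead from
  \<sigma> j back to itself modulo \<open>n\<close>.\<close>

lemma shifted_permutations_antichain:
  fixes \<pi> \<sigma> :: "nat \<Rightarrow> nat"
  assumes "inj \<pi>" "inj \<sigma>"
    and t: "t < n" "t \<noteq> 0" "even n \<longrightarrow> t \<noteq> n div 2"
    and shift: "\<And>i. i < n \<Longrightarrow> [\<pi> i = \<sigma> i + t] (mod n)"
    and "i < n" "j < n" and sub: "{\<pi> i, \<sigma> i} \<subseteq> {\<pi> j, \<sigma> j}"
  shows "i = j"
proof (rule ccontr)
  assume "i \<noteq> j"
  then have "\<pi> i = \<sigma> j" "\<sigma> i = \<pi> j"
    using sub assms(1,2) by (auto dest: injD)
  then have "[\<sigma> j = \<sigma> i + t] (mod n)" "[\<sigma> i = \<sigma> j + t] (mod n)"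
    using shift \<open>i < n\<close> \<open>j < n\<close> by metis+
  then have "[\<sigma> j = \<sigma> j + t + t] (mod n)"
    using cong_trans[OF _ cong_add[OF _ cong_refl]] by blast
  then have "[\<sigma> j + (t + t) = \<sigma> j + 0] (mod n)"
    by (simp add: cong_sym add.assoc)
  then have "[t + t = 0] (mod n)"
    by (simp only: cong_add_lcancel_nat)
  then have "n dvd t + t"
    by (simp add: cong_0_iff)
  then obtain q where q: "t + t = n * q" by auto
  \<comment> \<open>Since \<open>0 < t < n\<close>, the multiple \<open>t + t\<close> of
    \<open>n\<close> lies strictly between 0 and \<open>2 * n\<close>. It is therefore
    \<open>n\<close> itself, and \<open>t\<close> is the excluded half.\<close>
  have "n * q < n * 2"
    unfolding q[symmetric] using t(1) by simp
  then have "q < 2" by simp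
  moreover have "q \<noteq> 0" using q t(2) by (cases q) auto
  ultimately have "q = 1" by simp
  then have "n = 2 * t" using q by simp
  then show False using t(3) by simp
qed

text \<open>Only zero patterns matter, so one proof over a semiring without zero divisors and zero
  sums, with scalars from a set avoiding 0, serves both the tropical and the supertropical
  case.\<close>

lemma not_factorizable_shifted_permutations:
  fixes G :: "'s :: {comm_semiring_1, semiring_no_zero_divisors} set"
  assumes zero_sum_free: "\<forall>x y :: 's. x + y = 0 \<longrightarrow> x = 0" and G: "0 \<notin> G"
    and perm: "\<pi> permutes {..<n}" "\<sigma> permutes {..<n}" "\<pi> \<noteq> \<sigma>"
    and t: "t < n" "even n \<longrightarrow> t \<noteq> n div 2"
    and shift: "\<And>i. i < n \<Longrightarrow> [\<pi> i = \<sigma> i + t] (mod n)"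
    and D: "perm_supported G n \<pi> D\<^sub>\<pi>" "perm_supported G n \<sigma> D\<^sub>\<sigma>"
  shows "\<not> factorizable G n (D\<^sub>\<pi> + D\<^sub>\<sigma>)"
proof
  assume "factorizable G n (D\<^sub>\<pi> + D\<^sub>\<sigma>)"
  then obtain Es where Es: "\<forall>E \<in> set Es. elementary_mat G n E"
    and A: "D\<^sub>\<pi> + D\<^sub>\<sigma> = foldr (*) Es (1\<^sub>m n)"
    unfolding factorizable_def by blast
  have bound: "\<pi> i < n" "\<sigma> i < n" if "i < n" for i
    using perm that permutes_in_image by (metis lessThan_iff)+
  have t0: "t \<noteq> 0"
  proof
    assume "t = 0"
    then have "\<pi> i = \<sigma> i" if "i < n" for i
      using shift[OF that] bound[OF that] by (simp add: cong_def)
    \<comment> \<open>Both permutations fix every point outside the index set, so agreement on the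
      index set makes them equal as functions.\<close>
    moreover have "\<pi> i = \<sigma> i" if "\<not> i < n" for i
      using perm(1,2) that by (simp add: permutes_def)
    ultimately show False using perm(3) by blast
  qed
  \<comment> \<open>A nonzero shift separates the permutations at every index, so each row of the
    sum has exactly two nonzero entries.\<close>
  have ne: "\<pi> i \<noteq> \<sigma> i" if "i < n" for i
  proof
    assume "\<pi> i = \<sigma> i"
    then have "[\<sigma> i + 0 = \<sigma> i + t] (mod n)" using shift[OF that] by simp
    then show False
      using t0 t(1) by (simp only: cong_add_lcancel_nat) (simp add: cong_def)
  qed
  \<comment> \<open>The assumption names only the first summand; commutativity gives the second.
    Hence the support of a sum is the union of the supports.\<close>
  have sum_eq_0: "x + y = 0 \<longleftrightarrow> x = 0 \<and> y = 0" for x y :: 's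
    using zero_sum_free by (metis add.commute add_0)
  have entry: "D $$ (i, j) = 0 \<longleftrightarrow> j \<noteq> \<rho> i"
    if "perm_supported G n \<rho> D" "i < n" "j < n" for D \<rho> i j
    using that G unfolding perm_supported_def by metis
  have supp: "row_support (D\<^sub>\<pi> + D\<^sub>\<sigma>) i = {\<pi> i, \<sigma> i}" if "i < n" for i
  proof -
    have "D\<^sub>\<pi> \<in> carrier_mat n n" "D\<^sub>\<sigma> \<in> carrier_mat n n"
      using D unfolding perm_supported_def by auto
    then show ?thesis
      using that entry[OF D(1) that] entry[OF D(2) that] bound[OF that]
      by (auto simp: row_support_def sum_eq_0)
  qed
  have antichain: "i = j" if "i < n" "j < n"
    "row_support (D\<^sub>\<pi> + D\<^sub>\<sigma>) i \<subseteq> row_support (D\<^sub>\<pi> + D\<^sub>\<sigma>) j" for i j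
    using shifted_permutations_antichain[OF permutes_inj[OF perm(1)] permutes_inj[OF perm(2)]
        t(1) t0 t(2) shift that(1,2)] that by (simp add: supp)
  \<comment> \<open>One row suffices for the contradiction between at most one and exactly two
    nonzero entries; row 0 exists.\<close>
  have "0 < n" using t(1) by simp
  then have "card (row_support (D\<^sub>\<pi> + D\<^sub>\<sigma>) 0) \<le> 1"
    using elementary_product_antichain_rows[OF zero_sum_free G Es] antichain
    unfolding A by blast
  then show False
    using supp[OF \<open>0 < n\<close>] ne[OF \<open>0 < n\<close>] by simp
qed

instance tropical :: (linordered_ab_group_add) semiring_no_zero_divisors
proof
  fix x y :: "'a tropical"
  show "x \<noteq> 0 \<Longrightarrow> y \<noteq> 0 \<Longrightarrow> x * y \<noteq> 0"
    by (cases x; cases y) (auto simp: zero_tropical_def)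
qed

instance supertropical :: (linordered_ab_group_add) semiring_no_zero_divisors
proof
  fix x y :: "'a supertropical"
  show "x \<noteq> 0 \<Longrightarrow> y \<noteq> 0 \<Longrightarrow> x * y \<noteq> 0"
    by (cases x; cases y) (auto simp: zero_supertropical_def)
qed

lemma tropical_zero_sum_free:
  "\<forall>x y :: 'g :: linordered_ab_group_add tropical. x + y = 0 \<longrightarrow> x = 0"
proof (intro allI)
  fix x y :: "'g tropical"
  show "x + y = 0 \<longrightarrow> x = 0"
    by (cases x; cases y) (auto simp: plus_tropical_def zero_tropical_def max_def split: if_splits)
qed

text \<open>Equal nonzero \<nu>-values add up to a ghost, never to 0; for different ones the sum is
  the summand of larger value, which is nonzero.\<close>

lemma supertropical_zero_sum_free:
  "\<forall>x y :: 'g :: linordered_ab_group_add supertropical. x + y = 0 \<longrightarrow> x = 0"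
proof (intro allI)
  fix x y :: "'g supertropical"
  show "x + y = 0 \<longrightarrow> x = 0"
    by (cases x; cases y)
      (auto simp: plus_supertropical_def zero_supertropical_def less_tropical_def split: if_splits)
qed

theorem proposition3p2:
  fixes n :: nat and \<pi> \<sigma> :: "nat \<Rightarrow> nat"
  assumes "n > 2"
    and "\<pi> permutes {..<n}" and "\<sigma> permutes {..<n}" and "\<pi> \<noteq> \<sigma>"
    and "\<exists>t<n. (even n \<longrightarrow> t \<noteq> n div 2) \<and> (\<forall>i<n. [\<pi> i = \<sigma> i + t] (mod n))"
  shows "(\<forall>D\<^sub>\<pi> D\<^sub>\<sigma> :: 'g :: linordered_ab_group_add tropical mat.
           invertible_mat D\<^sub>\<pi> \<longrightarrow> invertible_mat D\<^sub>\<sigma> \<longrightarrow>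
           perm_supported (range Trop) n \<pi> D\<^sub>\<pi> \<longrightarrow>
           perm_supported (range Trop) n \<sigma> D\<^sub>\<sigma> \<longrightarrow>
           \<not> factorizable (range Trop) n (D\<^sub>\<pi> + D\<^sub>\<sigma>)) \<and>
         (\<forall>D\<^sub>\<pi> D\<^sub>\<sigma> :: 'g :: linordered_ab_group_add supertropical mat.
           invertible_mat D\<^sub>\<pi> \<longrightarrow> invertible_mat D\<^sub>\<sigma> \<longrightarrow>
           perm_supported (range Tangible) n \<pi> D\<^sub>\<pi> \<longrightarrow>
           perm_supported (range Tangible) n \<sigma> D\<^sub>\<sigma> \<longrightarrow>
           \<not> factorizable (range Tangible) n (D\<^sub>\<pi> + D\<^sub>\<sigma>))"
proof -
  obtain t where t: "t < n" "even n \<longrightarrow> t \<noteq> n div 2"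
    and shift: "\<And>i. i < n \<Longrightarrow> [\<pi> i = \<sigma> i + t] (mod n)"
    using assms(5) by blast
  have "(0 :: 'g tropical) \<notin> range Trop"
    by (auto simp: zero_tropical_def)
  moreover have "(0 :: 'g supertropical) \<notin> range Tangible"
    by (auto simp: zero_supertropical_def)
  ultimately show ?thesis
    using not_factorizable_shifted_permutations[OF tropical_zero_sum_free _ assms(2-4) t shift]
      not_factorizable_shifted_permutations[OF supertropical_zero_sum_free _ assms(2-4) t shift]
    by blast
qed

end
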